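(* Let $b\ge2$, $d\ge2$ and $m\ge1$ be integers, $n=b^m$, and let $\tilde{\boldsymbol{x}}_0,\dots,\tilde{\boldsymbol{x}}_{n-1}\in[0,1]^d$ be the points of a digital net constructed in base $b$ using permutation matrices as generators. Then the points $\boldsymbol{x}_0,\dots,\boldsymbol{x}_{n-1}\in[0,1]^d$ with components $x_{ij}=1-(1/n+\tilde x_{ij})$, for $0\le i<n$ and $1\le j\le d$, are NNLD.
   Context: Digital net in base $b$ with permutation matrix generators: let $\pi_1,\dots,\pi_d$ be permutations of $\{1,\dots,m\}$ and let the generator matrices $C^{(1)},\dots,C^{(d)}\in\{0,1\}^{m\times m}$ be given by $C^{(j)}_{rs}=1$ if $\pi_j(r)=s$ and $C^{(j)}_{rs}=0$ otherwise. For $0\le i<n=b^m$ write $i=\sum_{k=1}^m a_{i,k}b^{k-1}$ with $a_{i,k}\in\{0,\dots,b-1\}$ and $\vec i=(a_{i,1},\dots,a_{i,m})^{\mathsf T}$. The $j$-th component of the $i$-th point is obtained by taking the entries of $C^{(j)}\vec i \bmod b$ as base $b$ digits, i.e. $\tilde x_{ij}=\sum_{k=1}^m b^{-k}a_{i,\pi_j(k)}$. Points $\boldsymbol{x}_0,\dots,\boldsymbol{x}_{n-1}\in[0,1]^d$ (counted with multiplicity) are NNLD (have non-negative local discrepancy) if for every $\boldsymbol{z}\in[0,1]^d$, $$\frac1n\#\{0\le i<n: 0\le x_{ij}<z_j\text{ for all }j=1,\dots,d\}\ \ge\ \prod_{j=1}^d z_j.$$ *)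

theory Defs
  imports "HOL-Analysis.Analysis" "HOL-Combinatorics.Permutations"
begin

text \<open>
  Digit positions, matrix rows and columns, and coordinates are numbered from 1; points are
  numbered from 0. A family of points in \<open>d\<close> dimensions is a function \<open>x\<close>
  with \<open>x i j\<close> the \<open>j\<close>-th coordinate of point \<open>i\<close>;
  only the coordinates in \<open>{1..d}\<close> matter.
\<close>

definition digit :: "nat \<Rightarrow> nat \<Rightarrow> nat \<Rightarrow> nat" where
  "digit b i k = i div b ^ (k - 1) mod b"

definition digital_net :: "nat \<Rightarrow> nat \<Rightarrow> (nat \<Rightarrow> nat \<Rightarrow> nat \<Rightarrow> nat) \<Rightarrow> nat \<Rightarrow> nat \<Rightarrow> real" where
  "digital_net b m C i j =
     (\<Sum>k=1..m. real ((\<Sum>s=1..m. C j k s * digit b i s) mod b) / real b ^ k)"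

definition permutation_matrix :: "(nat \<Rightarrow> nat) \<Rightarrow> nat \<Rightarrow> nat \<Rightarrow> nat" where
  "permutation_matrix \<sigma> r s = (if \<sigma> r = s then 1 else 0)"

definition nnld :: "nat \<Rightarrow> nat \<Rightarrow> (nat \<Rightarrow> nat \<Rightarrow> real) \<Rightarrow> bool" where
  "nnld d n x \<longleftrightarrow>
     (\<forall>z \<in> {1..d} \<rightarrow> {0..1}.
        real (card {i. i < n \<and> (\<forall>j\<in>{1..d}. 0 \<le> x i j \<and> x i j < z j)}) / real n
          \<ge> (\<Prod>j=1..d. z j))"

lemma digit_less: "b \<ge> 1 \<Longrightarrow> digit b i k < b"
  by (simp add: digit_def)

lemma digit_expansion:
  assumes "i < b ^ m"
  shows "i = (\<Sum>k=1..m. digit b i k * b ^ (k - 1))"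
proof -
  have "i mod b ^ m = (\<Sum>k=1..m. digit b i k * b ^ (k - 1))"
  proof (induction m)
    case (Suc m)
    have "i mod b ^ Suc m = b ^ m * (i div b ^ m mod b) + i mod b ^ m"
      using mod_mult2_eq[of i "b ^ m" b] by (simp add: mult.commute)
    with Suc show ?case
      by (simp add: digit_def mult.commute)
  qed simp
  with assms show ?thesis by simp
qed

lemma digital_net_permutation_matrix:
  assumes "b \<ge> 1" "\<pi> j permutes {1..m}"
  shows "digital_net b m (\<lambda>j. permutation_matrix (\<pi> j)) i j
           = (\<Sum>k=1..m. real (digit b i (\<pi> j k)) / real b ^ k)"
  unfolding digital_net_def
proof (rule sum.cong[OF refl])
  fix k assume "k \<in> {1..m}"
  then have "\<pi> j k \<in> {1..m}"
    using permutes_in_image[OF assms(2)] by blast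
  then have "(\<Sum>s=1..m. permutation_matrix (\<pi> j) k s * digit b i s) = digit b i (\<pi> j k)"
    by (simp add: permutation_matrix_def if_distrib[of "\<lambda>c. c * _"] sum.delta cong: if_cong)
  then show "real ((\<Sum>s=1..m. permutation_matrix (\<pi> j) k s * digit b i s) mod b) / real b ^ k
      = real (digit b i (\<pi> j k)) / real b ^ k"
    using digit_less[OF assms(1)] by simp
qed

end

theory Submission
  imports Defs
begin

text \<open>
  Drawing the index \<open>i\<close> uniformly from \<open>{0..<b ^ m}\<close> makes its digits independent and
  uniform. Each coordinate \<open>x i j\<close> is antitone in every digit, so all the events
  \<open>x i j < z j\<close> are up-sets in the product order and hence positively correlated, by
  Harris' inequality. Each coordinate takes every value \<open>t / n\<close> with \<open>0 \<le> t < n\<close> exactly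
  once, so the \<open>j\<close>-th event alone has probability at least \<open>z j\<close>.
\<close>

text \<open>Harris' inequality with the expectations cleared of denominators. Splitting off one
  coordinate \<open>k\<close> slices the cube into fibres: the induction hypothesis bounds the
  product \<open>F c * G c\<close> of the two sums over each fibre, and since \<open>F\<close> and
  \<open>G\<close> are themselves monotone in \<open>c\<close>, Chebyshev's sum inequality combines
  the fibres.\<close>

lemma harris:
  fixes f g :: "('a \<Rightarrow> nat) \<Rightarrow> real"
  assumes "finite I"
    and "\<And>w w'. \<lbrakk>w \<in> I \<rightarrow>\<^sub>E {..<b}; w' \<in> I \<rightarrow>\<^sub>E {..<b}; \<And>i. i \<in> I \<Longrightarrow> w i \<le> w' i\<rbrakk> \<Longrightarrow> f w \<le> f w'"
    and "\<And>w w'. \<lbrakk>w \<in> I \<rightarrow>\<^sub>E {..<b}; w' \<in> I \<rightarrow>\<^sub>E {..<b}; \<And>i. i \<in> I \<Longrightarrow> w i \<le> w' i\<rbrakk> \<Longrightarrow> g w \<le> g w'"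
  shows "(\<Sum>w\<in>I \<rightarrow>\<^sub>E {..<b}. f w) * (\<Sum>w\<in>I \<rightarrow>\<^sub>E {..<b}. g w)
           \<le> real (b ^ card I) * (\<Sum>w\<in>I \<rightarrow>\<^sub>E {..<b}. f w * g w)"
  using assms
proof (induction I arbitrary: f g rule: finite_induct)
  case empty
  then show ?case by simp
next
  case (insert k I)
  let ?W = "I \<rightarrow>\<^sub>E {..<b}"
  have split: "(\<Sum>w\<in>insert k I \<rightarrow>\<^sub>E {..<b}. h w) = (\<Sum>c=0..<b. \<Sum>w\<in>?W. h (w(k := c)))"
    for h :: "('a \<Rightarrow> nat) \<Rightarrow> real"
  proof -
    have "(\<Sum>w\<in>insert k I \<rightarrow>\<^sub>E {..<b}. h w) = (\<Sum>(c, w)\<in>{..<b} \<times> ?W. h (w(k := c)))"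
      unfolding PiE_insert_eq
      using insert.hyps inj_combinator[of k I "\<lambda>_. {..<b}"]
      by (subst sum.reindex) (auto simp: case_prod_beta)
    then show ?thesis
      by (simp add: sum.cartesian_product lessThan_atLeast0)
  qed
  have upd: "w(k := c) \<in> insert k I \<rightarrow>\<^sub>E {..<b}" if "w \<in> ?W" "c < b" for w c
    using that by (auto simp: PiE_iff extensional_def)
  define F G where "F c = (\<Sum>w\<in>?W. f (w(k := c)))" and "G c = (\<Sum>w\<in>?W. g (w(k := c)))" for c
  have F: "F c \<le> F c'" if "c \<le> c'" "c' < b" for c c'
    unfolding F_def using that by (intro sum_mono insert.prems(1) upd) auto
  have G: "G c \<le> G c'" if "c \<le> c'" "c' < b" for c c'
    unfolding G_def using that by (intro sum_mono insert.prems(2) upd) auto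
  have fibre: "F c * G c \<le> real (b ^ card I) * (\<Sum>w\<in>?W. f (w(k := c)) * g (w(k := c)))"
    if "c < b" for c
    unfolding F_def G_def
    using that by (intro insert.IH insert.prems upd) auto
  have "(\<Sum>c=0..<b. F c) * (\<Sum>c=0..<b. G c) \<le> real b * (\<Sum>c=0..<b. F c * G c)"
    \<comment> \<open>The library form pairs an increasing with a decreasing sequence; negating
      \<open>G\<close> reverses the inequality.\<close>
    using Chebyshev_sum_upper[of b F "\<lambda>c. - G c"] F G by (simp add: sum_negf)
  also have "\<dots> \<le> real b *
      (\<Sum>c=0..<b. real (b ^ card I) * (\<Sum>w\<in>?W. f (w(k := c)) * g (w(k := c))))"
    by (intro mult_left_mono sum_mono fibre) auto
  finally show ?case
    using insert.hyps by (simp add: split F_def G_def flip: sum_distrib_left)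
qed

text \<open>A product of nonnegative monotone functions is again monotone, so at each induction step
  \<open>harris\<close> applies to \<open>f k\<close> and the product over the remaining
  indices.\<close>

lemma harris_prod:
  fixes f :: "'j \<Rightarrow> ('a \<Rightarrow> nat) \<Rightarrow> real"
  assumes "finite J" "finite I" "b > 0"
    and "\<And>j w w'. \<lbrakk>j \<in> J; w \<in> I \<rightarrow>\<^sub>E {..<b}; w' \<in> I \<rightarrow>\<^sub>E {..<b}; \<And>i. i \<in> I \<Longrightarrow> w i \<le> w' i\<rbrakk>
           \<Longrightarrow> f j w \<le> f j w'"
    and "\<And>j w. j \<in> J \<Longrightarrow> f j w \<ge> 0"
  shows "(\<Prod>j\<in>J. (\<Sum>w\<in>I \<rightarrow>\<^sub>E {..<b}. f j w) / real (b ^ card I))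
           \<le> (\<Sum>w\<in>I \<rightarrow>\<^sub>E {..<b}. \<Prod>j\<in>J. f j w) / real (b ^ card I)"
  using assms(1,4,5)
proof (induction J rule: finite_induct)
  case empty
  then show ?case using \<open>finite I\<close> \<open>b > 0\<close> by (simp add: card_PiE)
next
  case (insert k J)
  let ?W = "I \<rightarrow>\<^sub>E {..<b}" and ?N = "real (b ^ card I)"
  have N: "?N > 0" using \<open>b > 0\<close> by simp
  have "(\<Prod>j\<in>insert k J. (\<Sum>w\<in>?W. f j w) / ?N)
      = (\<Sum>w\<in>?W. f k w) / ?N * (\<Prod>j\<in>J. (\<Sum>w\<in>?W. f j w) / ?N)"
    using insert.hyps by simp
  also have "\<dots> \<le> (\<Sum>w\<in>?W. f k w) / ?N * ((\<Sum>w\<in>?W. \<Prod>j\<in>J. f j w) / ?N)"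
    using insert.prems insert.IH N by (intro mult_left_mono divide_nonneg_nonneg sum_nonneg) auto
  also have "\<dots> = (\<Sum>w\<in>?W. f k w) * (\<Sum>w\<in>?W. \<Prod>j\<in>J. f j w) / (?N * ?N)"
    by simp
  also have "\<dots> \<le> ?N * (\<Sum>w\<in>?W. f k w * (\<Prod>j\<in>J. f j w)) / (?N * ?N)"
    using \<open>finite I\<close> insert.prems
    by (intro divide_right_mono harris prod_mono) auto
  also have "\<dots> = (\<Sum>w\<in>?W. \<Prod>j\<in>insert k J. f j w) / ?N"
    using N insert.hyps by simp
  finally show ?case .
qed

text \<open>Turns averages over \<open>i\<close> into averages over the digit cube on which
  \<open>harris\<close> lives. Digits determine \<open>i\<close> by \<open>digit_expansion\<close>,
  and both sets have \<open>b ^ m\<close> elements.\<close>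

lemma bij_betw_digits:
  assumes "b > 0"
  shows "bij_betw (\<lambda>i. \<lambda>k\<in>{1..m}. digit b i k) {..<b ^ m} ({1..m} \<rightarrow>\<^sub>E {..<b})"
    (is "bij_betw ?D _ _")
proof (rule bij_betw_imageI)
  show inj: "inj_on ?D {..<b ^ m}"
  proof (rule inj_onI)
    fix i i' assume i: "i \<in> {..<b ^ m}" "i' \<in> {..<b ^ m}" and eq: "?D i = ?D i'"
    have "digit b i k = digit b i' k" if "k \<in> {1..m}" for k
      using fun_cong[OF eq, of k] that by simp
    then show "i = i'"
      using i digit_expansion[of i b m] digit_expansion[of i' b m] by simp
  qed
  show "?D ` {..<b ^ m} = {1..m} \<rightarrow>\<^sub>E {..<b}"
  proof (rule card_subset_eq)
    show "?D ` {..<b ^ m} \<subseteq> {1..m} \<rightarrow>\<^sub>E {..<b}"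
      using assms digit_less[of b] by auto
    show "card (?D ` {..<b ^ m}) = card ({1..m} \<rightarrow>\<^sub>E {..<b})"
      unfolding card_image[OF inj] by (simp add: card_PiE)
  qed (simp add: finite_PiE)
qed

text \<open>The sum is \<open>b ^ m\<close> times a net coordinate, so each one-dimensional
  projection of the net is the full grid. On a finite set it is enough to show surjectivity.\<close>

lemma bij_betw_permuted_digits:
  assumes "b > 0" "\<sigma> permutes {1..m}"
  shows "bij_betw (\<lambda>i. \<Sum>k=1..m. digit b i (\<sigma> k) * b ^ (m - k)) {..<b ^ m} {..<b ^ m}"
    (is "bij_betw ?T ?A ?A")
proof -
  have surj: "?A \<subseteq> ?T ` ?A"
  proof
    fix t assume t: "t \<in> ?A"
    \<comment> \<open>The weight \<open>b ^ (m - k)\<close> belongs to digit number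
      \<open>m + 1 - k\<close> of \<open>t\<close>, and this digit must stand at position
      \<open>l = \<sigma> k\<close>, hence \<open>k = inv \<sigma> l\<close>.\<close>
    define w where "w = (\<lambda>l\<in>{1..m}. digit b t (m + 1 - inv \<sigma> l))"
    have "w \<in> {1..m} \<rightarrow>\<^sub>E {..<b}"
      using assms(1) digit_less[of b] by (auto simp: w_def)
    then have "w \<in> (\<lambda>i. \<lambda>k\<in>{1..m}. digit b i k) ` ?A"
      by (simp only: bij_betw_imp_surj_on[OF bij_betw_digits[OF assms(1)]])
    then obtain i where i: "i \<in> ?A" "(\<lambda>k\<in>{1..m}. digit b i k) = w"
      by (elim imageE) (simp only:)
    have "digit b i (\<sigma> k) = digit b t (m + 1 - k)" if "k \<in> {1..m}" for k
    proof -
      have "\<sigma> k \<in> {1..m}" using permutes_in_image[OF assms(2), of k] that by blast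
      then show ?thesis
        using fun_cong[OF i(2), of "\<sigma> k"] permutes_inverses(2)[OF assms(2)] by (simp add: w_def)
    qed
    then have "?T i = (\<Sum>k=1..m. digit b t (m + 1 - k) * b ^ (m - k))"
      by simp
    also have "\<dots> = (\<Sum>k=1..m. digit b t k * b ^ (k - 1))"
      by (rule sum.reindex_bij_witness[of _ "\<lambda>k. m + 1 - k" "\<lambda>k. m + 1 - k"]) auto
    also have "\<dots> = t"
      using digit_expansion[of t b m] t by simp
    finally show "t \<in> ?T ` ?A" using i(1) by (intro image_eqI[of t ?T i]) simp_all
  qed
  then have "?T ` ?A = ?A"
    using card_seteq[of "?T ` ?A" ?A] card_image_le[of ?A ?T] by (simp only: finite_imageI finite_lessThan)
  then show ?thesis
    by (simp add: bij_betw_def eq_card_imp_inj_on)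
qed

text \<open>Reflection and the shift by \<open>1 / n\<close> turn the grid into 0, 1/n, ...,
  (n-1)/n, and at least \<lceil>n z\<rceil> of these values lie strictly below
  \<open>z\<close>.\<close>

lemma card_grid_ge:
  fixes z :: real
  assumes "z \<in> {0..1}" "n > 0"
  shows "real n * z \<le> card {t. t < n \<and> 1 - (1 / real n + real t / real n) < z}"
    (is "_ \<le> real (card ?S)")
proof -
  define c where "c = nat \<lceil>real n * z\<rceil>"
  have "real n * z \<le> real n"
    using assms by (simp add: mult_left_le)
  then have c: "c \<le> n" unfolding c_def by linarith
  have "(\<lambda>s. n - 1 - s) ` {..<c} \<subseteq> ?S"
  proof clarify
    fix s assume "s < c"
    then have s: "real s < real n * z" "s < n"
      using c unfolding c_def by linarith+
    have "1 - (1 / real n + real (n - 1 - s) / real n) = real s / real n"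
      using s by (simp add: field_simps of_nat_diff)
    also have "\<dots> < z"
      using s assms by (simp add: field_simps)
    finally show "n - 1 - s < n \<and> 1 - (1 / real n + real (n - 1 - s) / real n) < z"
      using s by simp
  qed
  moreover have "inj_on (\<lambda>s. n - 1 - s) {..<c}"
    using c by (intro inj_onI) auto
  ultimately have "c \<le> card ?S"
    using card_inj_on_le[of "\<lambda>s. n - 1 - s" "{..<c}" ?S] by simp
  then show ?thesis unfolding c_def by linarith
qed

theorem corollary3:
  fixes b d m n :: nat
    and \<pi> :: "nat \<Rightarrow> nat \<Rightarrow> nat"
    and x :: "nat \<Rightarrow> nat \<Rightarrow> real"
  assumes "b \<ge> 2" and "d \<ge> 2" and "m \<ge> 1" and "n = b ^ m"
    and "\<forall>j\<in>{1..d}. \<pi> j permutes {1..m}"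
    and "\<forall>i<n. \<forall>j\<in>{1..d}.
           x i j = 1 - (1 / real n + digital_net b m (\<lambda>j. permutation_matrix (\<pi> j)) i j)"
  shows "(\<forall>i<n. x i \<in> {1..d} \<rightarrow> {0..1}) \<and> nnld d n x"
proof -
  have b: "b > 0" and n: "n > 0" using assms by auto
  \<comment> \<open>The integer numerator of the net coordinate over the common denominator
    \<open>n\<close>.\<close>
  define T where "T j i = (\<Sum>k=1..m. digit b i (\<pi> j k) * b ^ (m - k))" for j i
  have bij: "bij_betw (T j) {..<n} {..<n}" if "j \<in> {1..d}" for j
    unfolding T_def using bij_betw_permuted_digits[OF b] assms(4,5) that by blast
  have x_sum: "x i j = 1 - (1 / real n + (\<Sum>k=1..m. real (digit b i (\<pi> j k)) / real b ^ k))"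
    if "i < n" "j \<in> {1..d}" for i j
    using assms(1,5,6) that by (simp add: digital_net_permutation_matrix)
  have x_T: "x i j = 1 - (1 / real n + real (T j i) / real n)" if "i < n" "j \<in> {1..d}" for i j
  proof -
    have "real (digit b i (\<pi> j k)) / real b ^ k = real (digit b i (\<pi> j k) * b ^ (m - k)) / real n"
      if "k \<in> {1..m}" for k
    proof -
      have "b ^ m = b ^ (m - k) * b ^ k"
        using that by (simp flip: power_add)
      then show ?thesis using b by (simp add: assms(4))
    qed
    then show ?thesis
      by (simp add: x_sum[OF that] T_def sum_divide_distrib)
  qed
  have range: "0 \<le> x i j \<and> x i j \<le> 1" if "i < n" "j \<in> {1..d}" for i j
  proof -
    have "T j i < n" using bij[OF that(2)] that(1) by (auto simp: bij_betw_def)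
    \<comment> \<open>Integrality leaves exactly the room that the shift by \<open>1 / n\<close>
      needs to keep \<open>x i j\<close> nonnegative.\<close>
    then have "real (T j i) + 1 \<le> real n" by linarith
    then show ?thesis using n by (simp add: x_T[OF that] field_simps)
  qed
  have "(\<Prod>j=1..d. z j) \<le> real (card {i. i < n \<and> (\<forall>j\<in>{1..d}. 0 \<le> x i j \<and> x i j < z j)}) / real n"
    if z: "z \<in> {1..d} \<rightarrow> {0..1}" for z
  proof -
    let ?W = "{1..m} \<rightarrow>\<^sub>E {..<b}"
    \<comment> \<open>The indicator of \<open>x i j < z j\<close> as a function of the digit vector.
      Larger digits raise the net coordinate and so lower its reflection, which makes
      \<open>f j\<close> monotone.\<close>
    define f :: "nat \<Rightarrow> (nat \<Rightarrow> nat) \<Rightarrow> real" where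
      "f j w = of_bool (1 - (1 / real n + (\<Sum>k=1..m. real (w (\<pi> j k)) / real b ^ k)) < z j)" for j w
    have perm: "\<pi> j k \<in> {1..m}" if "j \<in> {1..d}" "k \<in> {1..m}" for j k
      using assms(5) that permutes_in_image[of "\<pi> j" "{1..m}" k] by blast
    have f_mono: "f j w \<le> f j w'" if "j \<in> {1..d}" "\<And>l. l \<in> {1..m} \<Longrightarrow> w l \<le> w' l" for j w w'
    proof -
      have "(\<Sum>k=1..m. real (w (\<pi> j k)) / real b ^ k) \<le> (\<Sum>k=1..m. real (w' (\<pi> j k)) / real b ^ k)"
        using that perm by (intro sum_mono divide_right_mono) auto
      then show ?thesis by (auto simp: f_def)
    qed
    have f_x: "f j (\<lambda>k\<in>{1..m}. digit b i k) = of_bool (x i j < z j)" if "i < n" "j \<in> {1..d}" for i j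
    proof -
      have "(\<Sum>k=1..m. real ((\<lambda>k\<in>{1..m}. digit b i k) (\<pi> j k)) / real b ^ k)
          = (\<Sum>k=1..m. real (digit b i (\<pi> j k)) / real b ^ k)"
        using perm[OF that(2)] by (intro sum.cong) auto
      then show ?thesis by (simp only: f_def x_sum[OF that])
    qed
    have reindex: "(\<Sum>w\<in>?W. h w) = (\<Sum>i<n. h (\<lambda>k\<in>{1..m}. digit b i k))" for h :: "_ \<Rightarrow> real"
      using sum.reindex_bij_betw[OF bij_betw_digits[OF b, of m], of h] assms(4) by simp
    have marginal: "z j \<le> (\<Sum>w\<in>?W. f j w) / real n" if j: "j \<in> {1..d}" for j
    proof -
      let ?P = "\<lambda>t. 1 - (1 / real n + real t / real n) < z j"
      have "(\<Sum>w\<in>?W. f j w) = (\<Sum>i<n. of_bool (?P (T j i)))"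
        unfolding reindex using j by (intro sum.cong) (simp_all only: f_x x_T lessThan_iff)
      \<comment> \<open>\<open>T j\<close> permutes the indices below \<open>n\<close>, so the
        marginal count depends neither on \<open>\<pi> j\<close> nor on the other
        coordinates.\<close>
      also have "\<dots> = (\<Sum>t<n. of_bool (?P t))"
        by (rule sum.reindex_bij_betw[OF bij[OF j]])
      also have "\<dots> = real (card {t. t < n \<and> ?P t})"
        by (simp add: Int_def)
      also have "\<dots> \<ge> real n * z j"
        using z j n by (intro card_grid_ge) auto
      finally show ?thesis using n by (simp add: field_simps)
    qed
    have "(\<Prod>j=1..d. z j) \<le> (\<Prod>j=1..d. (\<Sum>w\<in>?W. f j w) / real n)"
      using z marginal by (intro prod_mono) auto
    also have "\<dots> \<le> (\<Sum>w\<in>?W. \<Prod>j=1..d. f j w) / real n"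
    proof -
      have N: "n = b ^ card {1..m}" using assms(4) by simp
      have "f j w \<ge> 0" for j w
        by (simp add: f_def)
      then show ?thesis
        unfolding N by (intro harris_prod f_mono b finite_atLeastAtMost)
    qed
    \<comment> \<open>By \<open>range\<close> the condition \<open>0 \<le> x i j\<close> always
      holds, so the product of the indicators is the indicator of the box counted in
      \<open>nnld\<close>.\<close>
    also have "(\<Sum>w\<in>?W. \<Prod>j=1..d. f j w)
        = (\<Sum>i<n. of_bool (\<forall>j\<in>{1..d}. 0 \<le> x i j \<and> x i j < z j))"
      unfolding reindex
    proof (rule sum.cong[OF refl])
      fix i assume "i \<in> {..<n}"
      then have "(\<Prod>j=1..d. f j (\<lambda>k\<in>{1..m}. digit b i k)) = (\<Prod>j=1..d. of_bool (0 \<le> x i j \<and> x i j < z j))"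
        by (intro prod.cong) (simp_all only: f_x range lessThan_iff simp_thms)
      also have "\<dots> = of_bool (\<forall>j\<in>{1..d}. 0 \<le> x i j \<and> x i j < z j)"
        by (induction d) (auto simp: atLeastAtMostSuc_conv)
      finally show "(\<Prod>j=1..d. f j (\<lambda>k\<in>{1..m}. digit b i k)) = \<dots>" .
    qed
    also have "\<dots> = real (card {i. i < n \<and> (\<forall>j\<in>{1..d}. 0 \<le> x i j \<and> x i j < z j)})"
      by (simp add: Int_def)
    finally show ?thesis .
  qed
  then show ?thesis using range by (auto simp: nnld_def)
qed

end
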